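(* Let $e=2.7182\dots$ be the Euler number. Then $$\frac{e}{2}=1+\cfrac{1}{2+\cfrac{3}{3+\cfrac{4}{4+\cfrac{5}{5+\ddots}}}}.$$ That is, $e/2$ has the continued fraction expansion $b_0+\cfrac{a_1}{b_1+\cfrac{a_2}{b_2+\ddots}}$ with $b_n=n+1$ for all $n\ge 0$, $a_1=1$, and $a_n=n+1$ for all $n\ge 2$.
   Context: For sequences of numbers $(a_n)_{n\ge1}$ and $(b_n)_{n\ge0}$, the $n$-th convergent $A_n/B_n$ of the (generalized) continued fraction $b_0+\cfrac{a_1}{b_1+\cfrac{a_2}{b_2+\ddots}}$ is its truncation at $a_n/b_n$. The sequences $(A_n)$, $(B_n)$ satisfy $A_n=b_nA_{n-1}+a_nA_{n-2}$ and $B_n=b_nB_{n-1}+a_nB_{n-2}$ for $n\ge1$, with $A_{-1}=1$, $A_0=b_0$, $B_{-1}=0$, $B_0=1$. A number $x$ has this continued fraction expansion (equivalently, $x$ equals the continued fraction) if $\lim_{n\to\infty}A_n/B_n=x$. *)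

theory Defs
  imports Complex_Main
begin

text \<open>
  Continued fractions $b_0 + a_1/(b_1 + a_2/(b_2 + \ldots))$. The value \<open>a 0\<close> is never used. The
  conventional initial values $A_{-1} = 1$ and $B_{-1} = 0$ are folded into the equations for
  index 1.
\<close>

fun cf_num :: "(nat \<Rightarrow> 'a::field) \<Rightarrow> (nat \<Rightarrow> 'a) \<Rightarrow> nat \<Rightarrow> 'a" where
  "cf_num a b 0 = b 0"
| "cf_num a b (Suc 0) = b 1 * b 0 + a 1 * 1"
| "cf_num a b (Suc (Suc n)) =
     b (Suc (Suc n)) * cf_num a b (Suc n) + a (Suc (Suc n)) * cf_num a b n"

fun cf_denom :: "(nat \<Rightarrow> 'a::field) \<Rightarrow> (nat \<Rightarrow> 'a) \<Rightarrow> nat \<Rightarrow> 'a" where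
  "cf_denom a b 0 = 1"
| "cf_denom a b (Suc 0) = b 1 * 1 + a 1 * 0"
| "cf_denom a b (Suc (Suc n)) =
     b (Suc (Suc n)) * cf_denom a b (Suc n) + a (Suc (Suc n)) * cf_denom a b n"

definition cf_convergent :: "(nat \<Rightarrow> 'a::field) \<Rightarrow> (nat \<Rightarrow> 'a) \<Rightarrow> nat \<Rightarrow> 'a" where
  "cf_convergent a b n = cf_num a b n / cf_denom a b n"

text \<open>
  The first conjunct keeps the convention \<open>x / 0 = 0\<close> from contributing to the limit.
\<close>

definition has_cf_expansion ::
    "'a::real_normed_field \<Rightarrow> (nat \<Rightarrow> 'a) \<Rightarrow> (nat \<Rightarrow> 'a) \<Rightarrow> bool" where
  "has_cf_expansion x a b \<longleftrightarrow>
     (\<forall>\<^sub>F n in sequentially. cf_denom a b n \<noteq> 0) \<and> cf_convergent a b \<longlonglongrightarrow> x"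

text \<open>
  \<open>cf_truncation a b k n\<close> is the finite fraction $b_k + a_{k+1}/(b_{k+1} + \ldots + a_{k+n}/b_{k+n})$.
  For positive coefficients no division by zero occurs, and the truncation
  at $a_n/b_n$ is the \<open>n\<close>-th convergent.
\<close>

fun cf_truncation :: "(nat \<Rightarrow> 'a::field) \<Rightarrow> (nat \<Rightarrow> 'a) \<Rightarrow> nat \<Rightarrow> nat \<Rightarrow> 'a" where
  "cf_truncation a b k 0 = b k"
| "cf_truncation a b k (Suc n) = b k + a (Suc k) / cf_truncation a b (Suc k) n"

lemma cf_truncation_pos:
  fixes a b :: "nat \<Rightarrow> 'a::linordered_field"
  assumes "\<And>n. b n > 0" and "\<And>n. n \<ge> 1 \<Longrightarrow> a n > 0"
  shows "cf_truncation a b k n > 0"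
  by (induction n arbitrary: k) (auto intro!: add_pos_pos divide_pos_pos assms)

lemma cf_denom_pos:
  fixes a b :: "nat \<Rightarrow> 'a::linordered_field"
  assumes "\<And>n. b n > 0" and "\<And>n. n \<ge> 1 \<Longrightarrow> a n > 0"
  shows "cf_denom a b n > 0"
  using assms by (induction a b n rule: cf_denom.induct) (simp_all add: add_pos_pos)

lemma cf_truncation_eq_aux:
  fixes a b :: "nat \<Rightarrow> 'a::linordered_field"
  assumes "\<And>n. b n > 0" and "\<And>n. n \<ge> 1 \<Longrightarrow> a n > 0"
  defines "x \<equiv> cf_truncation a b"
  shows "(x (Suc (Suc k)) n * cf_num a b (Suc k) + a (Suc (Suc k)) * cf_num a b k) /
         (x (Suc (Suc k)) n * cf_denom a b (Suc k) + a (Suc (Suc k)) * cf_denom a b k)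
         = cf_convergent a b (Suc (Suc k) + n)"
proof (induction n arbitrary: k)
  case 0
  show ?case by (simp add: x_def cf_convergent_def)
next
  case (Suc n)
  let ?t = "x (Suc (Suc (Suc k))) n"
  have t: "?t > 0" unfolding x_def using assms(1,2) by (rule cf_truncation_pos)
  have s: "x (Suc (Suc k)) (Suc n) * p + q = (?t * (b (Suc (Suc k)) * p + q) + a (Suc (Suc (Suc k))) * p) / ?t"
    for p q using t by (simp add: x_def field_simps)
  have "(x (Suc (Suc k)) (Suc n) * cf_num a b (Suc k) + a (Suc (Suc k)) * cf_num a b k) /
        (x (Suc (Suc k)) (Suc n) * cf_denom a b (Suc k) + a (Suc (Suc k)) * cf_denom a b k)
      = (?t * cf_num a b (Suc (Suc k)) + a (Suc (Suc (Suc k))) * cf_num a b (Suc k)) /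
        (?t * cf_denom a b (Suc (Suc k)) + a (Suc (Suc (Suc k))) * cf_denom a b (Suc k))"
    unfolding s using t by simp
  also have "\<dots> = cf_convergent a b (Suc (Suc (Suc k)) + n)" by (rule Suc.IH)
  finally show ?case by simp
qed

lemma cf_truncation_eq_cf_convergent:
  fixes a b :: "nat \<Rightarrow> 'a::linordered_field"
  assumes "\<And>n. b n > 0" and "\<And>n. n \<ge> 1 \<Longrightarrow> a n > 0"
  shows "cf_truncation a b 0 n = cf_convergent a b n"
proof -
  consider "n = 0" | "n = 1" | m where "n = Suc (Suc m)"
    by (metis One_nat_def not0_implies_Suc)
  then show ?thesis
  proof cases
    case 3
    let ?t = "cf_truncation a b 2 m"
    have t: "?t > 0" using assms by (rule cf_truncation_pos)
    have d: "?t * b 1 + a 2 > 0" using t assms by (simp add: add_pos_pos)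
    have "b 1 + a 2 / ?t = (?t * b 1 + a 2) / ?t" using t by (simp add: field_simps)
    then have "cf_truncation a b 0 n = b 0 + a 1 * ?t / (?t * b 1 + a 2)"
      using 3 by (simp add: numeral_2_eq_2)
    also have "\<dots> = (?t * (b 1 * b 0 + a 1) + a 2 * b 0) / (?t * b 1 + a 2)"
      using d by (simp add: field_simps)
    also have "\<dots> = cf_convergent a b n"
      using cf_truncation_eq_aux[of b a 0 m, OF assms] 3 by (simp add: numeral_2_eq_2)
    finally show ?thesis .
  qed (use assms(1)[of 1] in \<open>auto simp: cf_convergent_def field_simps\<close>)
qed

end

theory Submission
  imports Defs
begin

text \<open>
  Both sequences of the continued fraction satisfy
  $X_n = (n + 1)(X_{n-1} + X_{n-2})$ for $n \ge 2$, which is Euler's recurrence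
  $d_m = (m - 1)(d_{m-1} + d_{m-2})$ for the derangement numbers with $m = n + 2$. It has
  the two solutions $m!$ and
  $d_m = m! \sum_{k \le m} (-1)^k / k!$, and the initial values
  $A_0 = 1$, $A_1 = 3$ and $B_0 = 1$, $B_1 = 2$ select
  $A_n = (n + 2)!/2$ and $B_n = d_{n+2}$. Hence $B_n / A_n$ is twice a partial sum of the
  exponential series for $e^{-1}$, and $A_n / B_n$ tends to $e/2$.
\<close>

definition exp_minus_one_sum :: "nat \<Rightarrow> real" where
  "exp_minus_one_sum m = (\<Sum>k\<le>m. (-1) ^ k / fact k)"

lemma exp_minus_one_sum_tendsto: "exp_minus_one_sum \<longlonglongrightarrow> exp (-1)"
proof -
  have "(\<lambda>k. (-1) ^ k / fact k) sums exp (-1 :: real)"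
    using exp_converges[of "-1 :: real"] by (simp add: divide_inverse mult.commute)
  then show ?thesis
    unfolding sums_def_le exp_minus_one_sum_def [abs_def] .
qed

definition derangement_number :: "nat \<Rightarrow> real" where
  "derangement_number m = fact m * exp_minus_one_sum m"

lemma derangement_number_Suc:
  "derangement_number (Suc m) = real (Suc m) * derangement_number m + (-1) ^ Suc m"
proof -
  have "derangement_number (Suc m) = fact (Suc m) * exp_minus_one_sum m + (-1) ^ Suc m"
    by (simp add: derangement_number_def exp_minus_one_sum_def algebra_simps del: fact_Suc)
  then show ?thesis
    by (simp add: derangement_number_def)
qed

text \<open>
  Two consecutive instances of the one-step recurrence carry opposite signs, so adding them
  cancels the inhomogeneous terms.
\<close>

lemma derangement_number_Suc_Suc:
  "derangement_number (Suc (Suc m)) =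
     real (Suc m) * (derangement_number (Suc m) + derangement_number m)"
  by (simp add: derangement_number_Suc algebra_simps)

lemma cf_num_eq_fact:
  fixes a b :: "nat \<Rightarrow> real"
  assumes b: "\<And>n. b n = real n + 1"
    and a1: "a 1 = 1"
    and a: "\<And>n. n \<ge> 2 \<Longrightarrow> a n = real n + 1"
  shows "cf_num a b n = fact (n + 2) / 2"
proof (induction n rule: induct_nat_012)
  case 0
  show ?case by (simp add: b)
next
  case 1
  show ?case using a1 by (simp add: b fact_numeral)
next
  case (ge2 n)
  then show ?case by (simp add: a b field_simps)
qed

lemma cf_denom_eq_derangement_number:
  fixes a b :: "nat \<Rightarrow> real"
  assumes b: "\<And>n. b n = real n + 1"
    and a: "\<And>n. n \<ge> 2 \<Longrightarrow> a n = real n + 1"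
  shows "cf_denom a b n = derangement_number (n + 2)"
proof (induction n rule: induct_nat_012)
  case 0
  show ?case
    by (simp add: derangement_number_Suc derangement_number_def exp_minus_one_sum_def
        numeral_2_eq_2)
next
  case 1
  show ?case
    by (simp add: b derangement_number_Suc derangement_number_def exp_minus_one_sum_def
        numeral_2_eq_2)
next
  case (ge2 n)
  then show ?case
    using derangement_number_Suc_Suc[of "n + 2"] by (simp add: a b algebra_simps)
qed

theorem theorem1:
  fixes a b :: "nat \<Rightarrow> real"
  assumes "\<And>n. b n = real n + 1"
    and "a 1 = 1"
    and "\<And>n. n \<ge> 2 \<Longrightarrow> a n = real n + 1"
  shows "has_cf_expansion (exp 1 / 2) a b"
proof -
  have "a n > 0" if "n \<ge> 1" for n
    using that assms(2) assms(3)[of n] by (cases "n = 1") auto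
  then have "cf_denom a b n > 0" for n
    by (intro cf_denom_pos) (simp_all add: assms(1))
  then have nonzero: "\<forall>\<^sub>F n in sequentially. cf_denom a b n \<noteq> 0"
    by (intro always_eventually allI) (metis less_irrefl)
  have num: "cf_num a b n = fact (n + 2) / 2" for n
    using assms by (rule cf_num_eq_fact)
  have denom: "cf_denom a b n = fact (n + 2) * exp_minus_one_sum (n + 2)" for n
    using cf_denom_eq_derangement_number[of b a n] assms
    by (simp add: derangement_number_def del: fact_Suc)
  have "cf_convergent a b n = (1 / 2) / exp_minus_one_sum (n + 2)" for n
    unfolding cf_convergent_def num denom by (simp del: fact_Suc)
  then have "cf_convergent a b = (\<lambda>n. (1 / 2) / exp_minus_one_sum (n + 2))"
    by (rule ext)
  moreover have "(\<lambda>n. (1 / 2) / exp_minus_one_sum (n + 2)) \<longlonglongrightarrow> (1 / 2) / exp (-1)"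
    by (rule tendsto_divide [OF tendsto_const
          LIMSEQ_ignore_initial_segment [OF exp_minus_one_sum_tendsto]]) simp
  ultimately have "cf_convergent a b \<longlonglongrightarrow> exp 1 / 2"
    by (simp add: exp_minus divide_simps)
  with nonzero show ?thesis
    unfolding has_cf_expansion_def ..
qed

end
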